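(* Let $F$ be a distribution on $\mathbb{R}$ with a density, and let $X, X_1, X_2, \ldots$ be i.i.d. with distribution $F$, with mean $\mu = E[X]$. Suppose the tail $\bar F(x) = 1-F(x)$ satisfies $\bar F(x) = L(x)x^{-\alpha}$ for some slowly varying function $L$ and some $\alpha > 2$, and that $E|X|^{2+\delta}<\infty$ for some $\delta>0$. Let $\gamma=\gamma(n)$ satisfy $\gamma = n\mu + \omega(\sqrt{n\log n})$ as $n\to\infty$, and let the truncation level $u=u(n)$ satisfy $u \le \mu + O\big((\gamma-n\mu)/\sqrt{\log n}\big)$. Then, as $n\to\infty$, $$p(\tilde F_u) - p(F) = -p(F)(1+o(1)).$$
   Context: $S_n = X_1+\cdots+X_n$. For a distribution $G$ on $\mathbb{R}$, $p(G) = P_G(S_n>\gamma)$ denotes the probability that $S_n>\gamma$ when $X_1,\ldots,X_n$ are i.i.d. with distribution $G$. The truncated distribution $\tilde F_u$ is defined by $\tilde F_u(x) = F(x)/F(u)$ for $x\le u$ and $\tilde F_u(x)=1$ for $x>u$ (i.e., the law of $X$ conditioned on $X\le u$). Asymptotic notation: $a_n=o(b_n)$ means $a_n/b_n\to0$; $a_n=\omega(b_n)$ means $a_n/b_n\to\infty$; $a_n = O(b_n)$ means $|a_n/b_n|$ is bounded for all large $n$. *)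

theory Defs
  imports "HOL-Probability.Probability" "HOL-Library.Landau_Symbols"
begin

definition slowly_varying :: "(real \<Rightarrow> real) \<Rightarrow> bool" where
  "slowly_varying L \<longleftrightarrow>
     (\<forall>\<^sub>F x in at_top. L x > 0) \<and>
     (\<forall>c>0. ((\<lambda>x. L (c * x) / L x) \<longlongrightarrow> 1) at_top)"

definition trunc_dist :: "real measure \<Rightarrow> real \<Rightarrow> real measure" where
  "trunc_dist M u = density M (\<lambda>x. ennreal (indicator {..u} x / measure M {..u}))"

definition sum_tail_prob :: "nat \<Rightarrow> real measure \<Rightarrow> real \<Rightarrow> real" where
  "sum_tail_prob n G \<gamma> =
     measure (PiM {..<n} (\<lambda>_. G))
       {x \<in> space (PiM {..<n} (\<lambda>_. G)). (\<Sum>i<n. x i) > \<gamma>}"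

end

theory Submission
  imports Defs "HOL-Real_Asymp.Real_Asymp"
begin

text \<open>Write \<open>b = \<gamma> - n \<mu>\<close>. A single big jump gives \<open>p(F) \<ge> P(X > 2 b) / 2\<close>, which regular variation
  bounds below by a multiple of \<open>b powr (- \<alpha> - 1)\<close>. When the summands are truncated at
  \<open>\<mu> + O(b / sqrt (ln n))\<close>, the Chernoff bound with exponent \<open>\<theta> = K ln b / b\<close> applies for every
  constant \<open>K\<close>: the quadratic term \<open>n \<theta>\<^sup>2 \<sigma>\<^sup>2\<close> is \<open>o(ln b)\<close> because \<open>n ln b = o(b\<^sup>2)\<close>, and summands beyond
  \<open>\<mu> + 1 / \<theta>\<close> contribute at most \<open>n b powr o(1) P(X > \<mu> + 1 / \<theta>) = o(1)\<close> by the moment of order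
  \<open>2 + \<delta>\<close>. So the truncated probability decays faster than any fixed power of \<open>b\<close>.\<close>

section \<open>Polynomial lower bounds for regularly varying tails\<close>

text \<open>Since \<open>L (2 * x) / L x\<close> tends to 1, which exceeds
  \<open>2 powr (-\<epsilon>)\<close>, the function \<open>L x * x powr \<epsilon>\<close>
  eventually does not decrease when \<open>x\<close> doubles. Monotonicity of \<open>T\<close>
  bounds it below on one interval \<open>[x0, 2 * x0]\<close>, and doubling carries that bound to
  all larger \<open>x\<close>.\<close>

lemma slowly_varying_tail_lower:
  fixes T L :: "real \<Rightarrow> real"
  assumes L: "slowly_varying L"
    and T: "\<And>x. x > 0 \<Longrightarrow> T x = L x * x powr (-\<alpha>)"
    and anti: "\<And>x y. x \<le> y \<Longrightarrow> T y \<le> T x"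
    and \<epsilon>: "\<epsilon> > 0"
  obtains c x0 where "c > 0" "x0 > 0" "\<And>x. x \<ge> x0 \<Longrightarrow> T x \<ge> c * x powr (-(\<alpha> + \<epsilon>))"
proof -
  have "((\<lambda>x. L (2 * x) / L x) \<longlongrightarrow> 1) at_top"
    using L unfolding slowly_varying_def by force
  moreover have "2 powr (-\<epsilon>) < (1::real)"
    using \<epsilon> powr_less_mono[of "-\<epsilon>" 0 2] by simp
  ultimately have "\<forall>\<^sub>F x in at_top. L (2 * x) / L x > 2 powr (-\<epsilon>)"
    by (rule order_tendstoD)
  moreover have "\<forall>\<^sub>F x in at_top. L x > 0"
    using L unfolding slowly_varying_def by blast
  ultimately have "\<forall>\<^sub>F x in at_top. L (2 * x) / L x > 2 powr (-\<epsilon>) \<and> L x > 0 \<and> x > (0::real)"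
    using eventually_gt_at_top[of "0::real"] by eventually_elim auto
  then obtain x0 where x0: "\<And>x. x \<ge> x0 \<Longrightarrow> L (2 * x) / L x > 2 powr (-\<epsilon>) \<and> L x > 0 \<and> x > 0"
    unfolding eventually_at_top_linorder by blast
  have x0_pos: "x0 > 0" using x0 by blast
  define g where "g x = T x * x powr (\<alpha> + \<epsilon>)" for x
  have g: "g x = L x * x powr \<epsilon>" if "x > 0" for x
    using that by (simp add: g_def T powr_minus field_simps powr_add)
  have step: "g (2 * x) \<ge> g x" if "x \<ge> x0" for x
  proof -
    have "2 powr (-\<epsilon>) * L x \<le> L (2 * x)"
      using x0[OF that] pos_less_divide_eq[of "L x" "2 powr (-\<epsilon>)" "L (2 * x)"] by linarith
    then have "L x \<le> L (2 * x) * 2 powr \<epsilon>"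
      by (simp add: powr_minus field_simps)
    then have "L x * x powr \<epsilon> \<le> L (2 * x) * 2 powr \<epsilon> * x powr \<epsilon>"
      by (rule mult_right_mono) simp
    then show ?thesis
      using x0[OF that] by (simp add: g powr_mult ac_simps)
  qed
  \<comment> \<open>On \<open>[x0, 2 * x0]\<close> the tail is at least \<open>T (2 * x0)\<close>.
    The minimum over both endpoints covers either sign of \<open>\<alpha> + \<epsilon>\<close>,
    hence a power that increases or decreases.\<close>
  define c where "c = min (T (2 * x0) * x0 powr (\<alpha> + \<epsilon>)) (T (2 * x0) * (2 * x0) powr (\<alpha> + \<epsilon>))"
  have T_pos: "T (2 * x0) > 0"
    using x0[of "2 * x0"] x0_pos by (simp add: T)
  then have c_pos: "c > 0"
    using x0_pos by (simp add: c_def)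
  have base: "g x \<ge> c" if "x \<ge> x0" "x \<le> 2 * x0" for x
  proof -
    have "x powr (\<alpha> + \<epsilon>) \<ge> min (x0 powr (\<alpha> + \<epsilon>)) ((2 * x0) powr (\<alpha> + \<epsilon>))"
    proof (cases "\<alpha> + \<epsilon> \<ge> 0")
      case True
      then show ?thesis using that x0_pos by (intro min.coboundedI1 powr_mono2) auto
    next
      case False
      then show ?thesis using that x0_pos by (intro min.coboundedI2 powr_mono2') auto
    qed
    moreover have "c = T (2 * x0) * min (x0 powr (\<alpha> + \<epsilon>)) ((2 * x0) powr (\<alpha> + \<epsilon>))"
      using T_pos by (simp add: c_def min_mult_distrib_left)
    ultimately have "c \<le> T (2 * x0) * x powr (\<alpha> + \<epsilon>)"
      using T_pos by (simp add: mult_left_mono)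
    also have "\<dots> \<le> g x"
      unfolding g_def using anti[OF that(2)] by (rule mult_right_mono) simp
    finally show ?thesis .
  qed
  \<comment> \<open>Halving \<open>x\<close> repeatedly brings it into the base interval, and by
    \<open>step\<close> each halving does not increase \<open>g\<close>.\<close>
  have ind: "g x \<ge> c" if "x \<ge> x0" "x \<le> 2 ^ Suc k * x0" for x and k :: nat
    using that
  proof (induction k arbitrary: x)
    case 0
    then show ?case using base by simp
  next
    case (Suc k)
    show ?case
    proof (cases "x \<le> 2 * x0")
      case True
      then show ?thesis using base Suc by blast
    next
      case False
      then have "c \<le> g (x / 2)"
        using Suc.prems by (intro Suc.IH) auto
      also have "\<dots> \<le> g (2 * (x / 2))"
        using False by (intro step) auto
      finally show ?thesis by simp
    qed
  qed
  have "T x \<ge> c * x powr (-(\<alpha> + \<epsilon>))" if "x \<ge> x0" for x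
  proof -
    obtain k where "x / x0 < 2 ^ k"
      using real_arch_pow[of 2 "x / x0"] by auto
    then have "x \<le> 2 ^ Suc k * x0"
      using x0_pos that by (simp add: field_simps)
    then have "c \<le> T x * x powr (\<alpha> + \<epsilon>)"
      using ind[OF that] by (simp add: g_def)
    then show ?thesis
      using x0_pos that by (simp add: powr_minus field_simps del: minus_add_distrib)
  qed
  then show ?thesis using that c_pos x0_pos by blast
qed

section \<open>Exponential moments of truncated laws\<close>

text \<open>The indicator of the event is at most \<open>exp (\<theta> * (S - \<gamma>))\<close> for
  the sum \<open>S\<close>, whose integral factorises over the product. \<open>G\<close> is merely
  finite because \<open>trunc_dist M u\<close> may be the zero measure.\<close>

lemma sum_tail_prob_Chernoff:
  fixes G :: "real measure"
  assumes fin: "finite_measure G" and sets [measurable_cong]: "sets G = sets borel"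
    and mgf: "(\<integral>\<^sup>+ x. ennreal (exp (\<theta> * x)) \<partial>G) \<le> ennreal m"
    and nn: "\<theta> \<ge> 0" "m \<ge> 0"
  shows "sum_tail_prob n G \<gamma> \<le> exp (- \<theta> * \<gamma>) * m ^ n"
proof -
  interpret finite_measure G by fact
  interpret product_sigma_finite "\<lambda>_::nat. G" ..
  let ?P = "PiM {..<n} (\<lambda>_. G)"
  let ?A = "{x \<in> space ?P. (\<Sum>i<n. x i) > \<gamma>}"
  have [measurable]: "?A \<in> Sigma_Algebra.sets ?P" by measurable
  have "emeasure ?P ?A = (\<integral>\<^sup>+ x. indicator ?A x \<partial>?P)"
    by simp
  also have "\<dots> \<le> (\<integral>\<^sup>+ x. ennreal (exp (- \<theta> * \<gamma>)) * (\<Prod>i<n. ennreal (exp (\<theta> * x i))) \<partial>?P)"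
  proof (rule nn_integral_mono)
    fix x
    have "ennreal (exp (- \<theta> * \<gamma>)) * (\<Prod>i<n. ennreal (exp (\<theta> * x i)))
        = ennreal (exp (\<theta> * ((\<Sum>i<n. x i) - \<gamma>)))"
      by (simp add: prod_ennreal exp_sum[symmetric] sum_distrib_left[symmetric]
            ennreal_mult[symmetric] exp_add[symmetric] algebra_simps)
    moreover have "exp (\<theta> * ((\<Sum>i<n. x i) - \<gamma>)) \<ge> 1" if "x \<in> ?A"
      using that nn by simp
    ultimately show "indicator ?A x \<le> ennreal (exp (- \<theta> * \<gamma>)) * (\<Prod>i<n. ennreal (exp (\<theta> * x i)))"
      by (auto simp: indicator_def simp del: mem_Collect_eq)
  qed
  also have "\<dots> = ennreal (exp (- \<theta> * \<gamma>)) * (\<integral>\<^sup>+ x. ennreal (exp (\<theta> * x)) \<partial>G) ^ n"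
    by (subst nn_integral_cmult, measurable)
       (subst product_nn_integral_prod, auto)
  also have "\<dots> \<le> ennreal (exp (- \<theta> * \<gamma>)) * ennreal m ^ n"
    by (intro mult_left_mono power_mono mgf) auto
  also have "\<dots> = ennreal (exp (- \<theta> * \<gamma>) * m ^ n)"
    using nn by (simp add: ennreal_power ennreal_mult)
  finally show ?thesis
    unfolding sum_tail_prob_def measure_def using nn by (intro enn2real_leI) auto
qed

context real_distribution
begin

lemma prob_UNIV: "prob UNIV = 1"
  using prob_space by simp

lemma integrable_indicator_borel: "A \<in> sets borel \<Longrightarrow> integrable M (indicat_real A)"
  by (intro integrable_real_indicator) (auto simp: less_top[symmetric])

lemma sets_trunc_dist: "sets (trunc_dist M u) = sets borel"
  by (simp add: trunc_dist_def)

lemma tail_prob_antimono: "x \<le> y \<Longrightarrow> prob {y<..} \<le> prob {x<..}"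
  by (intro finite_measure_mono) auto

lemma integrable_exp_atMost:
  assumes "\<theta> \<ge> 0"
  shows "integrable M (\<lambda>x. indicator {..u} x * exp (\<theta> * x))"
  using assms
  by (intro integrable_const_bound[where B = "exp (\<theta> * u)"])
     (auto simp: indicator_def mult_left_mono)

lemma nn_integral_trunc_dist:
  assumes "f \<in> borel_measurable borel"
  shows "nn_integral (trunc_dist M u) f =
    (\<integral>\<^sup>+ x. ennreal (indicator {..u} x / prob {..u}) * f x \<partial>M)"
  unfolding trunc_dist_def using assms
  by (subst nn_integral_density) auto

lemma mgf_trunc_dist:
  assumes "\<theta> \<ge> 0"
  shows "(\<integral>\<^sup>+ x. ennreal (exp (\<theta> * x)) \<partial>trunc_dist M u)
     = ennreal ((\<integral>x. indicator {..u} x * exp (\<theta> * x) \<partial>M) / prob {..u})"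
proof -
  have "(\<integral>\<^sup>+ x. ennreal (exp (\<theta> * x)) \<partial>trunc_dist M u)
      = (\<integral>\<^sup>+ x. ennreal (indicator {..u} x * exp (\<theta> * x) / prob {..u}) \<partial>M)"
    by (subst nn_integral_trunc_dist) (auto simp: ennreal_mult[symmetric])
  also have "\<dots> = ennreal (\<integral>x. indicator {..u} x * exp (\<theta> * x) / prob {..u} \<partial>M)"
    using integrable_exp_atMost[OF assms] by (intro nn_integral_eq_integral) auto
  finally show ?thesis by simp
qed

text \<open>The total mass is the exponential moment at exponent 0. It is 1, except that division by
  zero makes it 0 when \<open>prob {..u} = 0\<close>.\<close>

lemma finite_measure_trunc_dist: "finite_measure (trunc_dist M u)"
proof
  have "emeasure (trunc_dist M u) (space (trunc_dist M u))
      = (\<integral>\<^sup>+ x. ennreal (exp (0 * x)) \<partial>trunc_dist M u)"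
    by simp
  also have "\<dots> < \<infinity>"
    by (subst mgf_trunc_dist) auto
  finally show "emeasure (trunc_dist M u) (space (trunc_dist M u)) \<noteq> \<infinity>" by simp
qed

text \<open>The values added to the average when \<open>u\<close> grows to \<open>v\<close> are all at least \<open>exp (\<theta> * u)\<close>,
  an upper bound of the old average. At \<open>prob {..u} = 0\<close> the left-hand side is \<open>0\<close>.\<close>

lemma mgf_trunc_mono:
  assumes "\<theta> \<ge> 0" "u \<le> v" "prob {..v} > 0"
  shows "(\<integral>x. indicator {..u} x * exp (\<theta> * x) \<partial>M) / prob {..u}
     \<le> (\<integral>x. indicator {..v} x * exp (\<theta> * x) \<partial>M) / prob {..v}"
proof (cases "prob {..u} = 0")
  case True
  then show ?thesis by (auto intro!: divide_nonneg_nonneg integral_nonneg_AE)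
next
  case False
  then have pu: "prob {..u} > 0" by (simp add: zero_less_measure_iff)
  let ?I = "\<lambda>u. \<integral>x. indicator {..u} x * exp (\<theta> * x) \<partial>M"
  note int = integrable_exp_atMost[OF assms(1)]
  have "?I u \<le> (\<integral>x. exp (\<theta> * u) * indicator {..u} x \<partial>M)"
    using assms(1) by (intro integral_mono int integrable_mult_right integrable_indicator_borel)
      (auto simp: indicator_def mult_left_mono)
  then have up: "?I u \<le> exp (\<theta> * u) * prob {..u}" by simp
  have pd: "prob {u<..v} = prob {..v} - prob {..u}"
    using assms(2) by (subst finite_measure_Diff[symmetric]) (auto intro!: arg_cong[where f=prob])
  have "?I u + exp (\<theta> * u) * prob {u<..v}
      = (\<integral>x. indicator {..u} x * exp (\<theta> * x) + exp (\<theta> * u) * indicator {u<..v} x \<partial>M)"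
    using int integrable_indicator_borel by (subst Bochner_Integration.integral_add) auto
  also have "\<dots> \<le> ?I v"
    using assms int by (intro integral_mono Bochner_Integration.integrable_add
        integrable_mult_right integrable_indicator_borel)
      (auto simp: indicator_def mult_left_mono)
  finally have "?I u + exp (\<theta> * u) * (prob {..v} - prob {..u}) \<le> ?I v"
    unfolding pd .
  then have "(?I u + exp (\<theta> * u) * (prob {..v} - prob {..u})) * prob {..u} \<le> ?I v * prob {..u}"
    using pu by (intro mult_right_mono) auto
  \<comment> \<open>When the two inequalities are added, the terms containing
    \<open>exp (\<theta> * u)\<close> cancel, which leaves the cross-multiplied claim.\<close>
  moreover have "?I u * (prob {..v} - prob {..u}) \<le> exp (\<theta> * u) * prob {..u} * (prob {..v} - prob {..u})"
    using up assms(2) by (intro mult_right_mono) (auto intro!: finite_measure_mono)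
  ultimately have "?I u * prob {..v} \<le> ?I v * prob {..u}"
    by (simp add: algebra_simps)
  then show ?thesis
    using pu assms(3) by (simp add: field_simps)
qed

end

section \<open>Bounds at fixed \<open>n\<close> under finite variance\<close>

locale square_integrable_distribution = real_distribution +
  assumes integrable_square: "integrable M (\<lambda>x. x\<^sup>2)"
begin

abbreviation "\<mu> \<equiv> expectation (\<lambda>x. x)"
abbreviation "\<sigma>2 \<equiv> variance (\<lambda>x. x)"

lemma integrable_ident: "integrable M (\<lambda>x. x)"
  by (rule square_integrable_imp_integrable[OF _ integrable_square]) simp

lemma integrable_centered_square: "integrable M (\<lambda>x. (x - \<mu>)\<^sup>2)"
  using integrable_square integrable_ident by (simp add: power2_diff)

lemma prob_greater_Chebyshev:
  assumes "t > 0"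
  shows "prob {\<mu> + t<..} \<le> \<sigma>2 / t\<^sup>2"
proof -
  have "prob {\<mu> + t<..} \<le> prob {x \<in> space M. \<bar>x - \<mu>\<bar> \<ge> t}"
    by (intro finite_measure_mono) auto
  also have "\<dots> \<le> \<sigma>2 / t\<^sup>2"
    using assms integrable_square by (intro Chebyshev_inequality) auto
  finally show ?thesis .
qed

text \<open>Integrating out the last coordinate first adds exactly one variance, since the cross
  term has mean zero. The nonnegative integral also delivers integrability of the square, which
  Markov's inequality needs afterwards.\<close>

lemma nn_integral_centered_sum_square:
  "(\<integral>\<^sup>+ x. ennreal ((\<Sum>i<n. x i - \<mu>)\<^sup>2) \<partial>PiM {..<n} (\<lambda>_. M)) = ennreal (real n * \<sigma>2)"
proof (induction n)
  case 0
  then show ?case by simp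
next
  case (Suc n)
  interpret product_sigma_finite "\<lambda>_::nat. M" ..
  interpret P: prob_space "PiM {..<n} (\<lambda>_. M)" by (intro prob_space_PiM) unfold_locales
  have inner: "(\<integral>\<^sup>+ y. ennreal ((s + (y - \<mu>))\<^sup>2) \<partial>M) = ennreal (s\<^sup>2) + ennreal \<sigma>2" for s
  proof -
    have eq: "(s + (y - \<mu>))\<^sup>2 = s\<^sup>2 + 2 * s * (y - \<mu>) + (y - \<mu>)\<^sup>2" for y
      by (simp add: power2_sum)
    have i1: "integrable M (\<lambda>y. s\<^sup>2 + 2 * s * (y - \<mu>))"
      using integrable_ident by auto
    have "integrable M (\<lambda>y. (s + (y - \<mu>))\<^sup>2)"
      unfolding eq using i1 integrable_centered_square by (rule Bochner_Integration.integrable_add)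
    then have "(\<integral>\<^sup>+ y. ennreal ((s + (y - \<mu>))\<^sup>2) \<partial>M) = ennreal (\<integral>y. (s + (y - \<mu>))\<^sup>2 \<partial>M)"
      by (intro nn_integral_eq_integral) auto
    also have "(\<integral>y. (s + (y - \<mu>))\<^sup>2 \<partial>M) = (\<integral>y. s\<^sup>2 + 2 * s * (y - \<mu>) \<partial>M) + \<sigma>2"
      unfolding eq using i1 integrable_centered_square by (rule Bochner_Integration.integral_add)
    also have "(\<integral>y. s\<^sup>2 + 2 * s * (y - \<mu>) \<partial>M) = s\<^sup>2"
      using integrable_ident by (subst Bochner_Integration.integral_add) (auto simp: prob_UNIV)
    finally show ?thesis by simp
  qed
  have "(\<integral>\<^sup>+ x. ennreal ((\<Sum>i<Suc n. x i - \<mu>)\<^sup>2) \<partial>PiM {..<Suc n} (\<lambda>_. M))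
      = (\<integral>\<^sup>+ x. (\<integral>\<^sup>+ y. ennreal ((\<Sum>i<Suc n. (x(n := y)) i - \<mu>)\<^sup>2) \<partial>M) \<partial>PiM {..<n} (\<lambda>_. M))"
    unfolding lessThan_Suc by (rule product_nn_integral_insert) auto
  also have "\<dots> = (\<integral>\<^sup>+ x. (\<integral>\<^sup>+ y. ennreal (((\<Sum>i<n. x i - \<mu>) + (y - \<mu>))\<^sup>2) \<partial>M) \<partial>PiM {..<n} (\<lambda>_. M))"
    by simp
  also have "\<dots> = (\<integral>\<^sup>+ x. ennreal ((\<Sum>i<n. x i - \<mu>)\<^sup>2) + ennreal \<sigma>2 \<partial>PiM {..<n} (\<lambda>_. M))"
    unfolding inner ..
  also have "\<dots> = ennreal (real (Suc n) * \<sigma>2)"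
    using Suc by (subst nn_integral_add)
      (auto simp: P.emeasure_space_1 ennreal_plus[symmetric] algebra_simps simp del: ennreal_plus)
  finally show ?case .
qed

text \<open>Chebyshev's inequality for the sum: the squared deviation is at least twice the variance
  \<open>real n * \<sigma>2\<close>. Using \<open>Suc n\<close> and \<open>\<sigma>2 + 1\<close>
  keeps the deviation positive even if \<open>n\<close> or the variance vanishes.\<close>

lemma sum_not_small:
  fixes n :: nat
  defines "P \<equiv> PiM {..<n} (\<lambda>_. M)"
  shows "measure P {x \<in> space P. (\<Sum>i<n. x i) > real n * \<mu> - sqrt (2 * real (Suc n) * (\<sigma>2 + 1))} \<ge> 1/2"
proof -
  interpret P: prob_space P unfolding P_def by (intro prob_space_PiM) unfold_locales
  define t where "t = sqrt (2 * real (Suc n) * (\<sigma>2 + 1))"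
  have V: "2 * real (Suc n) * (\<sigma>2 + 1) > 0"
    by (intro mult_pos_pos add_nonneg_pos) auto
  then have t: "t > 0" "t\<^sup>2 = 2 * real (Suc n) * (\<sigma>2 + 1)"
    unfolding t_def by (simp_all only: real_sqrt_gt_0_iff real_sqrt_pow2 less_imp_le)
  have [measurable]: "(\<lambda>x. \<Sum>i<n. x i) \<in> borel_measurable P" unfolding P_def by measurable
  have [measurable]: "(\<lambda>x. \<Sum>i<n. x i - \<mu>) \<in> borel_measurable P" unfolding P_def by measurable
  let ?A = "{x \<in> space P. (\<Sum>i<n. x i) > real n * \<mu> - t}"
  let ?B = "{x \<in> space P. (\<Sum>i<n. x i - \<mu>)\<^sup>2 \<ge> t\<^sup>2}"
  have V0: "\<sigma>2 \<ge> 0" by (rule variance_positive)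
  have "integrable P (\<lambda>x. (\<Sum>i<n. x i - \<mu>)\<^sup>2)
      \<and> (\<integral>x. (\<Sum>i<n. x i - \<mu>)\<^sup>2 \<partial>P) = real n * \<sigma>2"
  proof (rule nn_integral_eq_integrable[THEN iffD1])
    show "(\<integral>\<^sup>+ x. ennreal ((\<Sum>i<n. x i - \<mu>)\<^sup>2) \<partial>P) = ennreal (real n * \<sigma>2)"
      unfolding P_def by (rule nn_integral_centered_sum_square)
    show "0 \<le> real n * \<sigma>2" using V0 by (rule mult_nonneg_nonneg[OF of_nat_0_le_iff])
    show "(\<lambda>x. (\<Sum>i<n. x i - \<mu>)\<^sup>2) \<in> borel_measurable P" by measurable
  qed simp
  then have int: "integrable P (\<lambda>x. (\<Sum>i<n. x i - \<mu>)\<^sup>2)"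
    and val: "(\<integral>x. (\<Sum>i<n. x i - \<mu>)\<^sup>2 \<partial>P) = real n * \<sigma>2"
    by blast+
  have "measure P ?B \<le> (\<integral>x. (\<Sum>i<n. x i - \<mu>)\<^sup>2 \<partial>P) / t\<^sup>2"
    using int t(1) by (intro integral_Markov_inequality_measure[where A = "{}"]) auto
  also have "\<dots> \<le> 1/2"
  proof -
    have "2 * (real n * \<sigma>2) \<le> 2 * real (Suc n) * (\<sigma>2 + 1)"
      unfolding mult.assoc using V0 by (intro mult_left_mono mult_mono) auto
    then show ?thesis
      unfolding val t using V by (subst pos_divide_le_eq) linarith+
  qed
  finally have B: "measure P ?B \<le> 1/2" .
  have "space P - ?A \<subseteq> ?B"
  proof
    fix x assume "x \<in> space P - ?A"
    then have "t \<le> - (\<Sum>i<n. x i - \<mu>)" "x \<in> space P"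
      by (auto simp: sum_subtractf)
    then show "x \<in> ?B"
      using t(1) power_mono[of t "- (\<Sum>i<n. x i - \<mu>)" 2] by simp
  qed
  then have "measure P (space P - ?A) \<le> measure P ?B"
    by (intro P.finite_measure_mono) auto
  moreover have "measure P (space P - ?A) = 1 - measure P ?A"
    by (intro P.prob_compl) auto
  ultimately show ?thesis
    using B unfolding t_def by linarith
qed

text \<open>A single jump of the last summand carries the sum over the level while the other summands
  stay within a standard deviation of their mean.\<close>

lemma sum_tail_prob_lower:
  "sum_tail_prob (Suc n) M \<gamma>
     \<ge> 1/2 * prob {\<gamma> - real n * \<mu> + sqrt (2 * real (Suc n) * (\<sigma>2 + 1))<..}"
proof -
  interpret product_sigma_finite "\<lambda>_::nat. M" ..
  let ?P = "PiM {..<n} (\<lambda>_. M)" and ?Q = "PiM {..<Suc n} (\<lambda>_. M)"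
  interpret P: prob_space ?P by (intro prob_space_PiM) unfold_locales
  interpret Q: prob_space ?Q by (intro prob_space_PiM) unfold_locales
  define t where "t = sqrt (2 * real (Suc n) * (\<sigma>2 + 1))"
  let ?A = "{x \<in> space ?Q. (\<Sum>i<Suc n. x i) > \<gamma>}"
  let ?B = "{x \<in> space ?P. (\<Sum>i<n. x i) > real n * \<mu> - t}"
  have [measurable]: "?A \<in> sets ?Q" "?B \<in> sets ?P" by measurable
  have "ennreal (measure ?P ?B * prob {\<gamma> - real n * \<mu> + t<..})
      = (\<integral>\<^sup>+ x. indicator ?B x \<partial>?P) * (\<integral>\<^sup>+ y. indicator {\<gamma> - real n * \<mu> + t<..} y \<partial>M)"
    by (simp add: P.emeasure_eq_measure emeasure_eq_measure ennreal_mult)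
  also have "\<dots> = (\<integral>\<^sup>+ x. (\<integral>\<^sup>+ y. indicator ?B x * indicator {\<gamma> - real n * \<mu> + t<..} y \<partial>M) \<partial>?P)"
    by (simp add: nn_integral_cmult nn_integral_multc)
  \<comment> \<open>The first \<open>n\<close> summands fall short of their mean by less than
    \<open>t\<close>, and the last one exceeds the remaining distance by more than \<open>t\<close>,
    so the total exceeds \<open>\<gamma>\<close>.\<close>
  also have "\<dots> \<le> (\<integral>\<^sup>+ x. (\<integral>\<^sup>+ y. indicator ?A (x(n := y)) \<partial>M) \<partial>?P)"
  proof (intro nn_integral_mono)
    fix x y assume "x \<in> space ?P" "y \<in> space M"
    then have "x(n := y) \<in> space ?Q"
      by (auto simp: space_PiM PiE_iff extensional_def)
    then show "indicator ?B x * indicator {\<gamma> - real n * \<mu> + t<..} y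
        \<le> (indicator ?A (x(n := y)) :: ennreal)"
      by (auto simp: indicator_def)
  qed
  also have "\<dots> = (\<integral>\<^sup>+ x. indicator ?A x \<partial>?Q)"
    unfolding lessThan_Suc by (rule product_nn_integral_insert[symmetric]) (auto simp flip: lessThan_Suc)
  also have "\<dots> = ennreal (measure ?Q ?A)"
    by (simp add: Q.emeasure_eq_measure)
  finally have "measure ?P ?B * prob {\<gamma> - real n * \<mu> + t<..} \<le> measure ?Q ?A"
    by (simp add: ennreal_le_iff)
  moreover have "1/2 * prob {\<gamma> - real n * \<mu> + t<..} \<le> measure ?P ?B * prob {\<gamma> - real n * \<mu> + t<..}"
    using sum_not_small[of n] unfolding t_def by (intro mult_right_mono) auto
  ultimately show ?thesis
    unfolding sum_tail_prob_def t_def by linarith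
qed

text \<open>With \<open>z = \<theta> * (x - \<mu>)\<close>, the bound
  \<open>exp z \<le> 1 + z + z^2\<close> holds for \<open>z \<le> 1\<close>, and the linear term
  integrates to zero. Where \<open>z > 1\<close>, truncation gives
  \<open>exp z \<le> exp (\<theta> * t)\<close>, paid for by the probability of exceeding
  \<open>\<mu> + 1 / \<theta>\<close>.\<close>

lemma truncated_mgf_bound:
  assumes \<theta>: "\<theta> > 0" and t: "t > 0"
  shows "(\<integral>x. indicator {..\<mu> + t} x * exp (\<theta> * x) \<partial>M)
    \<le> exp (\<theta> * \<mu>) * (1 + \<theta>\<^sup>2 * \<sigma>2 + exp (\<theta> * t) * prob {\<mu> + 1 / \<theta><..})"
proof -
  let ?g = "\<lambda>x. (1 + \<theta> * (x - \<mu>)) + \<theta>\<^sup>2 * (x - \<mu>)\<^sup>2 + exp (\<theta> * t) * indicator {\<mu> + 1 / \<theta><..} x"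
  have i1: "integrable M (\<lambda>x. 1 + \<theta> * (x - \<mu>))"
    using integrable_ident by auto
  have i2: "integrable M (\<lambda>x. \<theta>\<^sup>2 * (x - \<mu>)\<^sup>2)"
    using integrable_centered_square by auto
  have i3: "integrable M (\<lambda>x. exp (\<theta> * t) * indicator {\<mu> + 1 / \<theta><..} x)"
    by (intro integrable_mult_right integrable_indicator_borel) auto
  have bound: "indicator {..\<mu> + t} x * exp (\<theta> * (x - \<mu>)) \<le> ?g x" for x
  proof -
    define z where "z = \<theta> * (x - \<mu>)"
    have zz: "\<theta>\<^sup>2 * (x - \<mu>)\<^sup>2 = z\<^sup>2" by (simp add: z_def power_mult_distrib)
    have nn: "0 \<le> 1 + z + z\<^sup>2"
      using sum_squares_ge_zero[of "z + 1/2" 0] by (simp add: power2_eq_square algebra_simps)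
    show ?thesis
    proof (cases "z \<le> 1")
      case True
      have "exp z \<le> 1 + z + z\<^sup>2"
      proof (cases "z \<ge> 0")
        case True
        then show ?thesis using exp_bound \<open>z \<le> 1\<close> by blast
      next
        case False
        define y where "y = - z"
        have y: "y \<ge> 0" using False by (simp add: y_def)
        \<comment> \<open>For negative \<open>z\<close> the claim is
          \<open>1 \<le> (1 + z + z^2) * exp y\<close>. Replacing \<open>exp y\<close> by its
          quadratic Taylor polynomial already suffices, as every surviving term of the product is
          nonnegative.\<close>
        have "1 \<le> (1 + z + z\<^sup>2) * (1 + y + y\<^sup>2 / 2)"
        proof -
          have "(1 + z + z\<^sup>2) * (1 + y + y\<^sup>2 / 2) = 1 + y\<^sup>2 / 2 + y ^ 3 / 2 + y ^ 4 / 2"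
            by (simp add: y_def field_simps power2_eq_square power3_eq_cube power4_eq_xxxx)
          then show ?thesis using y by simp
        qed
        also have "\<dots> \<le> (1 + z + z\<^sup>2) * exp y"
          using y nn by (intro mult_left_mono exp_lower_Taylor_quadratic) auto
        finally show ?thesis
          by (simp add: y_def exp_minus field_simps)
      qed
      then show ?thesis using nn unfolding zz z_def[symmetric]
        by (auto simp: indicator_def intro: add_increasing2)
    next
      case False
      then have x: "x > \<mu> + 1 / \<theta>"
        using \<theta> by (simp add: z_def field_simps)
      have "exp z \<le> exp (\<theta> * t)" if "x \<le> \<mu> + t"
        using that \<theta> by (simp add: z_def)
      then show ?thesis using x nn unfolding zz z_def[symmetric]
        by (auto simp: indicator_def intro: add_increasing)
    qed
  qed
  have "(\<integral>x. indicator {..\<mu> + t} x * exp (\<theta> * x) \<partial>M)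
      = (\<integral>x. exp (\<theta> * \<mu>) * (indicator {..\<mu> + t} x * exp (\<theta> * (x - \<mu>))) \<partial>M)"
    by (intro Bochner_Integration.integral_cong) (auto simp: right_diff_distrib exp_diff)
  also have "\<dots> = exp (\<theta> * \<mu>) * (\<integral>x. indicator {..\<mu> + t} x * exp (\<theta> * (x - \<mu>)) \<partial>M)"
    by simp
  also have "\<dots> \<le> exp (\<theta> * \<mu>) * (\<integral>x. ?g x \<partial>M)"
  proof (intro mult_left_mono integral_mono bound)
    show "integrable M (\<lambda>x. indicator {..\<mu> + t} x * exp (\<theta> * (x - \<mu>)))"
      using integrable_exp_atMost[of \<theta> "\<mu> + t"] \<theta>
        integrable_mult_left[of "exp (- \<theta> * \<mu>)" M "\<lambda>x. indicator {..\<mu> + t} x * exp (\<theta> * x)"]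
      by (simp add: right_diff_distrib exp_diff exp_minus divide_inverse mult.assoc)
  qed (use i1 i2 i3 in auto)
  also have "(\<integral>x. ?g x \<partial>M) = (\<integral>x. 1 + \<theta> * (x - \<mu>) \<partial>M) + \<theta>\<^sup>2 * \<sigma>2
      + exp (\<theta> * t) * prob {\<mu> + 1 / \<theta><..}"
    using i1 i2 i3 by (simp add: Bochner_Integration.integral_add)
  also have "(\<integral>x. 1 + \<theta> * (x - \<mu>) \<partial>M) = 1"
    using integrable_ident
    by (subst Bochner_Integration.integral_add) (auto simp: prob_UNIV)
  finally show ?thesis .
qed

text \<open>The Chernoff bound at level \<open>u\<close> is raised to level \<open>\<mu> + t\<close>
  by \<open>mgf_trunc_mono\<close>, so \<open>prob {..u}\<close> may be arbitrarily small. The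
  factor 2 is the cost of the normalisation at the higher level, and
  \<open>1 + r \<le> exp r\<close> handles the \<open>n\<close>-th power.\<close>

lemma sum_tail_prob_trunc_upper:
  assumes \<theta>: "\<theta> > 0" and t: "t > 0" and u: "u \<le> \<mu> + t"
    and small: "real n * prob {\<mu> + t<..} \<le> 1/2" and n: "n > 0"
  shows "sum_tail_prob n (trunc_dist M u) \<gamma> \<le>
    2 * exp (- \<theta> * (\<gamma> - real n * \<mu>) + real n * \<theta>\<^sup>2 * \<sigma>2
             + real n * exp (\<theta> * t) * prob {\<mu> + 1 / \<theta><..})"
proof -
  let ?I = "\<lambda>u. \<integral>x. indicator {..u} x * exp (\<theta> * x) \<partial>M"
  let ?v = "\<mu> + t"
  let ?r = "\<theta>\<^sup>2 * \<sigma>2 + exp (\<theta> * t) * prob {\<mu> + 1 / \<theta><..}"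
  have compl: "prob {..?v} = 1 - prob {?v<..}"
    by (subst prob_compl[symmetric]) (auto intro!: arg_cong[where f=prob])
  have "1 * prob {?v<..} \<le> real n * prob {?v<..}"
    using n by (intro mult_right_mono) auto
  then have small1: "prob {?v<..} \<le> 1/2" using small by simp
  then have pv: "prob {..?v} > 0" unfolding compl by linarith
  \<comment> \<open>Bernoulli's inequality turns \<open>small\<close> into a lower bound on the
    probability that none of \<open>n\<close> summands exceeds \<open>?v\<close>.\<close>
  have "1 + real n * (- prob {?v<..}) \<le> (1 + (- prob {?v<..})) ^ n"
    using small1 by (intro Bernoulli_inequality) linarith
  then have pvn: "1/2 \<le> prob {..?v} ^ n"
    using small unfolding compl by simp
  have I0: "?I u \<ge> 0" for u by (intro integral_nonneg_AE) auto
  have "sum_tail_prob n (trunc_dist M u) \<gamma> \<le> exp (- \<theta> * \<gamma>) * (?I u / prob {..u}) ^ n"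
    using \<theta> I0 by (intro sum_tail_prob_Chernoff finite_measure_trunc_dist)
      (auto simp: mgf_trunc_dist sets_trunc_dist)
  also have "\<dots> \<le> exp (- \<theta> * \<gamma>) * (?I ?v / prob {..?v}) ^ n"
    using \<theta> u pv I0 by (intro mult_left_mono power_mono mgf_trunc_mono) auto
  also have "\<dots> = exp (- \<theta> * \<gamma>) * ?I ?v ^ n * (1 / prob {..?v} ^ n)"
    by (simp add: power_divide)
  also have "\<dots> \<le> exp (- \<theta> * \<gamma>) * (exp (\<theta> * \<mu>) * exp ?r) ^ n * 2"
  proof (intro mult_mono power_mono)
    have "?I ?v \<le> exp (\<theta> * \<mu>) * (1 + \<theta>\<^sup>2 * \<sigma>2 + exp (\<theta> * t) * prob {\<mu> + 1 / \<theta><..})"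
      by (rule truncated_mgf_bound[OF \<theta> t])
    also have "\<dots> \<le> exp (\<theta> * \<mu>) * exp ?r"
      using exp_ge_add_one_self[of ?r] by (intro mult_left_mono) (simp_all only: add.assoc exp_ge_zero)
    finally show "?I ?v \<le> exp (\<theta> * \<mu>) * exp ?r" .
    show "1 / prob {..?v} ^ n \<le> 2"
      using pvn pv by (simp add: field_simps)
  qed (use I0 in auto)
  also have "\<dots> = 2 * exp (- \<theta> * (\<gamma> - real n * \<mu>) + real n * \<theta>\<^sup>2 * \<sigma>2
             + real n * exp (\<theta> * t) * prob {\<mu> + 1 / \<theta><..})"
    by (simp add: exp_add[symmetric] exp_of_nat_mult[symmetric] algebra_simps)
  finally show ?thesis .
qed

end

section \<open>Asymptotics of the two tail probabilities\<close>

text \<open>The third limit trades \<open>ln n\<close> for \<open>ln b\<close>, which may be far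
  larger. With \<open>q = b^2 / n\<close> one has \<open>ln b = (ln n + ln q) / 2\<close>, and
  \<open>ln q / q\<close> vanishes because \<open>q\<close> tends to infinity.\<close>

lemma filterlim_ln_over_square:
  fixes b :: "nat \<Rightarrow> real"
  assumes "filterlim (\<lambda>n. b n / sqrt (real n * ln (real n))) at_top at_top"
  shows "filterlim b at_top at_top"
    and "((\<lambda>n. real n * ln (real n) / (b n)\<^sup>2) \<longlongrightarrow> 0) at_top"
    and "((\<lambda>n. real n * ln (b n) / (b n)\<^sup>2) \<longlongrightarrow> 0) at_top"
proof -
  let ?s = "\<lambda>n::nat. sqrt (real n * ln (real n))"
  have s: "filterlim ?s at_top at_top" by real_asymp
  have "\<forall>\<^sub>F n in at_top. ?s n > 0"
    using s by (rule filterlim_at_top_dense[THEN iffD1, rule_format])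
  then have b_eq: "\<forall>\<^sub>F n in at_top. (b n / ?s n) * ?s n = b n"
    by eventually_elim (metis less_irrefl nonzero_divide_eq_eq)
  show b: "filterlim b at_top at_top"
    using filterlim_at_top_mult_at_top[OF assms s] b_eq
    by (rule filterlim_cong[OF refl refl, THEN iffD1, rotated])
  have ev: "\<forall>\<^sub>F n in at_top. n > 2 \<and> b n > 0"
    using eventually_gt_at_top[of "2::nat"] filterlim_at_top_dense[THEN iffD1, OF b, rule_format, of 0]
    by eventually_elim simp
  have "((\<lambda>n. inverse (b n / ?s n) ^ 2) \<longlongrightarrow> 0) at_top"
    using tendsto_power[OF tendsto_inverse_0_at_top[OF assms], of 2] by (simp only: zero_power2)
  moreover have "\<forall>\<^sub>F n in at_top. inverse (b n / ?s n) ^ 2 = real n * ln (real n) / (b n)\<^sup>2"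
    using ev by eventually_elim (simp add: power_divide)
  ultimately show lim1: "((\<lambda>n. real n * ln (real n) / (b n)\<^sup>2) \<longlongrightarrow> 0) at_top"
    by (rule Lim_transform_eventually)
  define q where "q n = (b n)\<^sup>2 / real n" for n
  have q: "filterlim q at_top at_top"
  proof -
    have "\<forall>\<^sub>F n in at_top. ln (real n) \<le> q n"
      using order_tendstoD(2)[OF lim1, of 1] ev
      by (auto simp: q_def field_simps elim: eventually_elim2)
    moreover have "filterlim (\<lambda>n::nat. ln (real n)) at_top at_top" by real_asymp
    ultimately show ?thesis by (rule filterlim_at_top_mono[rotated])
  qed
  have "((\<lambda>x::real. ln x / x) \<longlongrightarrow> 0) at_top" by real_asymp
  then have "((\<lambda>n. ln (q n) / q n) \<longlongrightarrow> 0) at_top"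
    using q by (rule filterlim_compose)
  then have "((\<lambda>n. (real n * ln (real n) / (b n)\<^sup>2 + ln (q n) / q n) / 2) \<longlongrightarrow> 0) at_top"
    using tendsto_divide[OF tendsto_add[OF lim1] tendsto_const, of "\<lambda>n. ln (q n) / q n" 0 2] by simp
  moreover have "\<forall>\<^sub>F n in at_top. (real n * ln (real n) / (b n)\<^sup>2 + ln (q n) / q n) / 2
      = real n * ln (b n) / (b n)\<^sup>2"
    using ev
  proof eventually_elim
    case (elim n)
    then have "ln (q n) = 2 * ln (b n) - ln (real n)"
      by (simp add: q_def ln_div ln_realpow)
    moreover have "z / q n = real n * z / (b n)\<^sup>2" for z
      by (simp add: q_def)
    ultimately show ?case
      by (simp add: add_divide_distrib[symmetric] distrib_left[symmetric] del: mult_cancel_left)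
  qed
  ultimately show "((\<lambda>n. real n * ln (b n) / (b n)\<^sup>2) \<longlongrightarrow> 0) at_top"
    by (rule Lim_transform_eventually)
qed

lemma (in real_distribution) prob_greater_moment:
  assumes "integrable M (\<lambda>x. \<bar>x\<bar> powr p)" "s > 0" "p > 0"
  shows "prob {s<..} \<le> expectation (\<lambda>x. \<bar>x\<bar> powr p) * s powr (-p)"
proof -
  have "prob {s<..} \<le> prob {x \<in> space M. \<bar>x\<bar> powr p \<ge> s powr p}"
    using assms by (intro finite_measure_mono) (auto intro!: powr_mono2)
  also have "\<dots> \<le> expectation (\<lambda>x. \<bar>x\<bar> powr p) / s powr p"
    using assms by (intro integral_Markov_inequality_measure[where A = "{}"]) auto
  finally show ?thesis by (simp add: powr_minus divide_inverse)
qed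

lemma (in square_integrable_distribution) sum_tail_prob_trunc_polynomial:
  fixes b u :: "nat \<Rightarrow> real"
  assumes moment: "integrable M (\<lambda>x. \<bar>x\<bar> powr (2 + \<delta>))" and \<delta>: "\<delta> > 0" and k: "k > 0"
    and gam: "filterlim (\<lambda>n. b n / sqrt (real n * ln (real n))) at_top at_top"
    and c: "c > 0" and u: "\<forall>\<^sub>F n in at_top. u n \<le> \<mu> + c * (b n / sqrt (ln (real n)))"
  shows "\<forall>\<^sub>F n in at_top. sum_tail_prob n (trunc_dist M (u n)) (real n * \<mu> + b n)
           \<le> 2 * exp 1 * b n powr (-k)"
proof -
  note b = filterlim_ln_over_square[OF gam]
  \<comment> \<open>The additional power of \<open>b\<close> absorbs the quadratic term of the
    exponent, which is at most \<open>ln (b n)\<close>; the remaining tail term costs only the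
    factor \<open>exp 1\<close>.\<close>
  define K where "K = k + 1"
  have K: "K > 0" using k by (simp add: K_def)
  define D where "D = expectation (\<lambda>x. \<bar>x\<bar> powr (2 + \<delta>))"
  define t where "t n = c * (b n / sqrt (ln (real n)))" for n
  define \<theta> where "\<theta> n = K * ln (b n) / b n" for n
  have ev_b: "\<forall>\<^sub>F n in at_top. b n > z" for z
    using b(1) by (rule filterlim_at_top_dense[THEN iffD1, rule_format])
  have ev1: "\<forall>\<^sub>F n in at_top. n > 2 \<and> b n > 1"
    using eventually_gt_at_top[of "2::nat"] ev_b[of 1] by eventually_elim simp
  have "((\<lambda>n. \<sigma>2 / c\<^sup>2 * (real n * ln (real n) / (b n)\<^sup>2)) \<longlongrightarrow> \<sigma>2 / c\<^sup>2 * 0) at_top"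
    by (intro tendsto_intros b)
  then have "\<forall>\<^sub>F n in at_top. \<sigma>2 / c\<^sup>2 * (real n * ln (real n) / (b n)\<^sup>2) < 1/2"
    by (rule order_tendstoD) simp
  then have small: "\<forall>\<^sub>F n in at_top. real n * prob {\<mu> + t n<..} \<le> 1/2"
    using ev1
  proof eventually_elim
    case (elim n)
    then have t: "t n > 0" using c by (auto simp: t_def)
    have "real n * prob {\<mu> + t n<..} \<le> real n * (\<sigma>2 / (t n)\<^sup>2)"
      by (intro mult_left_mono prob_greater_Chebyshev t) auto
    also have "\<dots> = \<sigma>2 / c\<^sup>2 * (real n * ln (real n) / (b n)\<^sup>2)"
      using elim by (simp add: t_def power_mult_distrib power_divide)
    finally show ?case using elim by linarith
  qed
  have "((\<lambda>n. K\<^sup>2 * \<sigma>2 * (real n * ln (b n) / (b n)\<^sup>2)) \<longlongrightarrow> K\<^sup>2 * \<sigma>2 * 0) at_top"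
    by (intro tendsto_intros b)
  then have "\<forall>\<^sub>F n in at_top. K\<^sup>2 * \<sigma>2 * (real n * ln (b n) / (b n)\<^sup>2) < 1"
    by (rule order_tendstoD) simp
  then have quad: "\<forall>\<^sub>F n in at_top. real n * (\<theta> n)\<^sup>2 * \<sigma>2 \<le> ln (b n)"
    using ev1
  proof eventually_elim
    case (elim n)
    have "real n * (\<theta> n)\<^sup>2 * \<sigma>2 = K\<^sup>2 * \<sigma>2 * (real n * ln (b n) / (b n)\<^sup>2) * ln (b n)"
      by (simp add: \<theta>_def power_mult_distrib power_divide power2_eq_square)
    also have "\<dots> \<le> 1 * ln (b n)"
      using elim by (intro mult_right_mono) auto
    finally show ?case by simp
  qed
  \<comment> \<open>Here \<open>\<theta> n * t n\<close> is \<open>ln (b n)\<close> times a quantity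
    of order \<open>1 / sqrt (ln n)\<close>. This is where the truncation scale enters:
    \<open>exp (\<theta> n * t n)\<close> is at most \<open>b n powr (\<delta> / 2)\<close>.\<close>
  have theta_t: "\<forall>\<^sub>F n in at_top. \<theta> n * t n \<le> \<delta> / 2 * ln (b n)"
  proof -
    have "((\<lambda>n. K * c / sqrt (ln (real n))) \<longlongrightarrow> 0) at_top"
      using K c by real_asymp
    then have "\<forall>\<^sub>F n in at_top. K * c / sqrt (ln (real n)) < \<delta> / 2"
      by (rule order_tendstoD) (use \<delta> in simp)
    then show ?thesis using ev1
    proof eventually_elim
      case (elim n)
      have "\<theta> n * t n = K * c / sqrt (ln (real n)) * ln (b n)"
        using elim by (simp add: \<theta>_def t_def)
      also have "\<dots> \<le> \<delta> / 2 * ln (b n)"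
        using elim by (intro mult_right_mono) auto
      finally show ?case .
    qed
  qed
  have n_le: "\<forall>\<^sub>F n in at_top. real n \<le> (b n)\<^sup>2"
  proof -
    have "\<forall>\<^sub>F n::nat in at_top. ln (real n) \<ge> 1" by real_asymp
    moreover have "\<forall>\<^sub>F n in at_top. real n * ln (real n) / (b n)\<^sup>2 < 1"
      using b(2) by (rule order_tendstoD) simp
    ultimately show ?thesis using ev1
    proof eventually_elim
      case (elim n)
      then have "real n * 1 \<le> real n * ln (real n)" by (intro mult_left_mono) auto
      moreover have "real n * ln (real n) < (b n)\<^sup>2" using elim by simp
      ultimately show ?case by linarith
    qed
  qed
  have large: "\<forall>\<^sub>F n in at_top. real n * exp (\<theta> n * t n) * prob {\<mu> + 1 / \<theta> n<..} \<le> 1"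
  proof -
    \<comment> \<open>Naming the mean makes it an atomic constant in the limits given to
      \<open>real_asymp\<close>.\<close>
    define m where "m = \<mu>"
    have pos: "\<forall>\<^sub>F x in at_top. m + x / (K * ln x) > 0"
      using K by real_asymp
    \<comment> \<open>With \<open>x\<close> for \<open>b n\<close>, the factors bound
      \<open>n\<close>, \<open>exp (\<theta> n * t n)\<close> and, by the moment of order
      \<open>2 + \<delta>\<close>, the tail probability. Up to logarithms and constants their
      product is \<open>x powr (-\<delta> / 2)\<close>.\<close>
    have "((\<lambda>x. x\<^sup>2 * x powr (\<delta> / 2) * (D * (m + x / (K * ln x)) powr (- (2 + \<delta>)))) \<longlongrightarrow> 0) at_top"
      using K \<delta> by real_asymp
    then have "\<forall>\<^sub>F x in at_top. x\<^sup>2 * x powr (\<delta> / 2) * (D * (m + x / (K * ln x)) powr (- (2 + \<delta>))) < 1"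
      by (rule order_tendstoD) simp
    with pos have "\<forall>\<^sub>F x in at_top. x\<^sup>2 * x powr (\<delta> / 2) * prob {m + x / (K * ln x)<..} < 1"
      using eventually_gt_at_top[of 0]
    proof eventually_elim
      case (elim x)
      have "x\<^sup>2 * x powr (\<delta> / 2) * prob {m + x / (K * ln x)<..}
          \<le> x\<^sup>2 * x powr (\<delta> / 2) * (D * (m + x / (K * ln x)) powr (- (2 + \<delta>)))"
        unfolding D_def using elim \<delta> moment
        by (intro mult_left_mono prob_greater_moment) auto
      then show ?case using elim by linarith
    qed
    then have "\<forall>\<^sub>F n in at_top. (b n)\<^sup>2 * b n powr (\<delta> / 2) * prob {m + b n / (K * ln (b n))<..} < 1"
      using b(1) by (rule eventually_compose_filterlim)
    then show ?thesis using ev1 theta_t n_le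
    proof eventually_elim
      case (elim n)
      have "exp (\<theta> n * t n) \<le> b n powr (\<delta> / 2)"
        using elim by (simp add: powr_def)
      then have "real n * exp (\<theta> n * t n) \<le> (b n)\<^sup>2 * b n powr (\<delta> / 2)"
        using elim by (intro mult_mono) auto
      then have "real n * exp (\<theta> n * t n) * prob {\<mu> + 1 / \<theta> n<..}
          \<le> (b n)\<^sup>2 * b n powr (\<delta> / 2) * prob {\<mu> + 1 / \<theta> n<..}"
        by (rule mult_right_mono) simp
      also have "\<dots> < 1"
        using elim by (simp add: \<theta>_def m_def)
      finally show ?case by simp
    qed
  qed
  show ?thesis
    using ev1 small quad large u
  proof eventually_elim
    case (elim n)
    have \<theta>_pos: "\<theta> n > 0" and t_pos: "t n > 0"
      using elim K c by (auto simp: \<theta>_def t_def)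
    have "sum_tail_prob n (trunc_dist M (u n)) (real n * \<mu> + b n)
        \<le> 2 * exp (- \<theta> n * (real n * \<mu> + b n - real n * \<mu>) + real n * (\<theta> n)\<^sup>2 * \<sigma>2
             + real n * exp (\<theta> n * t n) * prob {\<mu> + 1 / \<theta> n<..})"
      using elim by (intro sum_tail_prob_trunc_upper \<theta>_pos t_pos) (auto simp: t_def)
    also have "\<dots> \<le> 2 * exp (- K * ln (b n) + ln (b n) + 1)"
    proof -
      have "- \<theta> n * (real n * \<mu> + b n - real n * \<mu>) = - K * ln (b n)"
        using elim by (simp add: \<theta>_def)
      then show ?thesis using elim by (intro mult_left_mono) auto
    qed
    also have "\<dots> = 2 * exp 1 * b n powr (-k)"
      using elim by (simp add: K_def powr_def exp_add[symmetric] algebra_simps)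
    finally show ?case .
  qed
qed

text \<open>The jump required by \<open>sum_tail_prob_lower\<close> is \<open>b n + \<mu>\<close>
  plus a deviation of order \<open>sqrt n\<close>; eventually \<open>\<mu>\<close> and the deviation
  are each at most \<open>b n / 2\<close>.\<close>

lemma (in square_integrable_distribution) sum_tail_prob_ge_half_tail:
  fixes b :: "nat \<Rightarrow> real"
  assumes gam: "filterlim (\<lambda>n. b n / sqrt (real n * ln (real n))) at_top at_top"
  shows "\<forall>\<^sub>F n in at_top. sum_tail_prob n M (real n * \<mu> + b n) \<ge> 1/2 * prob {2 * b n<..}"
proof -
  note b = filterlim_ln_over_square[OF gam]
  have ev_b: "\<forall>\<^sub>F n in at_top. b n > z" for z
    using b(1) by (rule filterlim_at_top_dense[THEN iffD1, rule_format])
  \<comment> \<open>The 8 comes from squaring the target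
    \<open>sqrt (2 * real n * (\<sigma>2 + 1)) \<le> b n / 2\<close>.\<close>
  have "((\<lambda>n. 8 * (\<sigma>2 + 1) * (real n * ln (real n) / (b n)\<^sup>2)) \<longlongrightarrow> 8 * (\<sigma>2 + 1) * 0) at_top"
    by (intro tendsto_intros b)
  then have "\<forall>\<^sub>F n in at_top. 8 * (\<sigma>2 + 1) * (real n * ln (real n) / (b n)\<^sup>2) < 1"
    by (rule order_tendstoD) simp
  moreover have "\<forall>\<^sub>F n::nat in at_top. ln (real n) \<ge> 1" by real_asymp
  ultimately show ?thesis
    using ev_b[of "2 * \<bar>\<mu>\<bar> + 1"] eventually_gt_at_top[of "0::nat"]
  proof eventually_elim
    case (elim n)
    then obtain m where m: "n = Suc m" by (cases n) auto
    have b_pos: "b n > 0" using elim by linarith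
    have V: "\<sigma>2 + 1 > 0" using variance_positive[of "\<lambda>x. x"] by linarith
    have "8 * (\<sigma>2 + 1) * real n * 1 \<le> 8 * (\<sigma>2 + 1) * real n * ln (real n)"
      using elim V by (intro mult_left_mono) auto
    also have "\<dots> \<le> (b n)\<^sup>2"
      using elim b_pos by (simp add: field_simps)
    finally have "2 * real n * (\<sigma>2 + 1) \<le> (b n / 2)\<^sup>2"
      by (simp add: power_divide algebra_simps)
    then have sq: "sqrt (2 * real n * (\<sigma>2 + 1)) \<le> b n / 2"
      using b_pos by (intro real_le_lsqrt) auto
    have "1/2 * prob {2 * b n<..}
        \<le> 1/2 * prob {real n * \<mu> + b n - real m * \<mu> + sqrt (2 * real (Suc m) * (\<sigma>2 + 1))<..}"
    proof (intro mult_left_mono tail_prob_antimono)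
      have "real n * \<mu> - real m * \<mu> = \<mu>" by (simp add: m algebra_simps)
      then show "real n * \<mu> + b n - real m * \<mu> + sqrt (2 * real (Suc m) * (\<sigma>2 + 1)) \<le> 2 * b n"
        using sq elim unfolding m[symmetric] by linarith
    qed auto
    also have "\<dots> \<le> sum_tail_prob (Suc m) M (real n * \<mu> + b n)"
      by (rule sum_tail_prob_lower)
    finally show ?case unfolding m[symmetric] .
  qed
qed

section \<open>Comparison of the truncated and untruncated probabilities\<close>

theorem theorem1:
  fixes M :: "real measure" and \<alpha> \<delta> :: real and \<gamma> u :: "nat \<Rightarrow> real"
  assumes prob: "prob_space M"
    and dens: "\<exists>f. f \<in> borel_measurable borel \<and> (\<forall>x. f x \<ge> 0) \<and> M = density lborel f"
    and tail: "\<exists>L. slowly_varying L \<and> (\<forall>x>0. measure M {x<..} = L x * x powr (-\<alpha>))"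
    and alpha: "\<alpha> > 2"
    and delta: "\<delta> > 0"
    and moment: "integrable M (\<lambda>x. \<bar>x\<bar> powr (2 + \<delta>))"
    and gam: "filterlim (\<lambda>n. (\<gamma> n - real n * (\<integral>x. x \<partial>M)) / sqrt (real n * ln (real n)))
                at_top at_top"
    and trunc: "\<exists>a. a \<in> O(\<lambda>n. (\<gamma> n - real n * (\<integral>x. x \<partial>M)) / sqrt (ln (real n))) \<and>
                  (\<forall>\<^sub>F n in at_top. u n \<le> (\<integral>x. x \<partial>M) + a n)"
  shows "\<exists>e. e \<in> o(\<lambda>_. 1) \<and>
           (\<forall>\<^sub>F n in at_top.
              sum_tail_prob n (trunc_dist M (u n)) (\<gamma> n) - sum_tail_prob n M (\<gamma> n)
              = - sum_tail_prob n M (\<gamma> n) * (1 + e n))"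
proof -
  obtain f where "f \<in> borel_measurable borel" "M = density lborel f"
    using dens by blast
  then have sets_M: "sets M = sets borel" by simp
  interpret prob_space M by fact
  have "integrable M (\<lambda>x. x\<^sup>2)"
  proof (rule Bochner_Integration.integrable_bound)
    show "integrable M (\<lambda>x. 1 + \<bar>x\<bar> powr (2 + \<delta>))"
      using moment by auto
    show "(\<lambda>x. x\<^sup>2) \<in> borel_measurable M"
      by (simp add: measurable_cong_sets[OF sets_M refl])
    have "x\<^sup>2 \<le> 1 + \<bar>x\<bar> powr (2 + \<delta>)" for x :: real
    proof (cases "\<bar>x\<bar> \<le> 1")
      case True
      then have "x\<^sup>2 \<le> 1" by (simp add: abs_square_le_1)
      then show ?thesis by (simp add: add_increasing2)
    next
      case False
      then have "\<bar>x\<bar> powr 2 \<le> \<bar>x\<bar> powr (2 + \<delta>)" using delta by (intro powr_mono) auto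
      then show ?thesis using False by (simp add: powr_numeral)
    qed
    then show "AE x in M. norm (x\<^sup>2) \<le> norm (1 + \<bar>x\<bar> powr (2 + \<delta>))"
      by (intro AE_I2) (auto intro: order_trans)
  qed
  then interpret square_integrable_distribution M
    by unfold_locales (simp_all add: sets_M)
  define b where "b n = \<gamma> n - real n * \<mu>" for n
  have gam_b: "filterlim (\<lambda>n. b n / sqrt (real n * ln (real n))) at_top at_top"
    using gam by (simp add: b_def)
  note b = filterlim_ln_over_square[OF gam_b]
  have ev_b: "\<forall>\<^sub>F n in at_top. b n > z" for z
    using b(1) by (rule filterlim_at_top_dense[THEN iffD1, rule_format])
  have \<gamma>: "\<gamma> n = real n * \<mu> + b n" for n by (simp add: b_def)
  obtain a where a: "a \<in> O(\<lambda>n. b n / sqrt (ln (real n)))"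
    "\<forall>\<^sub>F n in at_top. u n \<le> \<mu> + a n"
    using trunc by (auto simp: b_def)
  obtain c where c: "c > 0"
    "\<forall>\<^sub>F n in at_top. norm (a n) \<le> c * norm (b n / sqrt (ln (real n)))"
    using a(1) by (rule landau_o.bigE)
  \<comment> \<open>The norms in the O-bound disappear because \<open>b n\<close> and
    \<open>ln (real n)\<close> are eventually positive.\<close>
  have u: "\<forall>\<^sub>F n in at_top. u n \<le> \<mu> + c * (b n / sqrt (ln (real n)))"
    using a(2) c(2) ev_b[of 0] eventually_gt_at_top[of "2::nat"]
    by eventually_elim (auto simp: abs_le_iff)
  obtain L where L: "slowly_varying L"
    "\<And>x. x > 0 \<Longrightarrow> prob {x<..} = L x * x powr (-\<alpha>)"
    using tail by blast
  obtain c' x0 where c': "c' > 0" "x0 > 0"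
    "\<And>x. x \<ge> x0 \<Longrightarrow> prob {x<..} \<ge> c' * x powr (-(\<alpha> + 1))"
    using slowly_varying_tail_lower[OF L tail_prob_antimono, of 1] by auto
  define p where "p n = sum_tail_prob n M (\<gamma> n)" for n
  define p' where "p' n = sum_tail_prob n (trunc_dist M (u n)) (\<gamma> n)" for n
  \<comment> \<open>This is \<open>2 * exp 1\<close> from \<open>upper\<close> divided by the
    constant \<open>c' * 2 powr (-(\<alpha> + 1)) / 2\<close> from \<open>lower\<close>.\<close>
  define B where "B = 4 * exp 1 * 2 powr (\<alpha> + 1) / c'"
  \<comment> \<open>The decay exponent is one more than the \<open>\<alpha> + 1\<close> of the lower
    bound, so that the ratio is of order \<open>1 / b n\<close>.\<close>
  have upper: "\<forall>\<^sub>F n in at_top. p' n \<le> 2 * exp 1 * b n powr (-(\<alpha> + 2))"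
    unfolding p'_def \<gamma> using alpha c
    by (intro sum_tail_prob_trunc_polynomial[OF moment delta _ gam_b _ u]) auto
  have lower: "\<forall>\<^sub>F n in at_top. p n \<ge> 1/2 * (c' * (2 * b n) powr (-(\<alpha> + 1)))"
    using sum_tail_prob_ge_half_tail[OF gam_b] ev_b[of x0]
  proof eventually_elim
    case (elim n)
    then have "c' * (2 * b n) powr (-(\<alpha> + 1)) \<le> prob {2 * b n<..}"
      using c'(2) by (intro c') auto
    then show ?case using elim unfolding p_def \<gamma> by linarith
  qed
  have ratio: "\<forall>\<^sub>F n in at_top. p n > 0 \<and> norm (- (p' n / p n)) \<le> B / b n"
    using upper lower ev_b[of 0]
  proof eventually_elim
    case (elim n)
    define l where "l = 1/2 * (c' * (2 * b n) powr (-(\<alpha> + 1)))"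
    have l: "l > 0" "l \<le> p n" using elim c' by (auto simp: l_def)
    have "p' n \<ge> 0" by (simp add: p'_def sum_tail_prob_def)
    then have "norm (- (p' n / p n)) = p' n / p n" using l by simp
    also have "\<dots> \<le> 2 * exp 1 * b n powr (-(\<alpha> + 2)) / l"
      using elim l \<open>p' n \<ge> 0\<close> by (intro frac_le) auto
    also have "\<dots> = B * (b n powr (-(\<alpha> + 2)) * b n powr (\<alpha> + 1))"
    proof -
      have "(2 * b n) powr (-(\<alpha> + 1)) = 1 / (2 powr (\<alpha> + 1) * b n powr (\<alpha> + 1))"
        using elim by (simp only: powr_minus_divide powr_mult)
      then show ?thesis by (simp add: l_def B_def)
    qed
    also have "b n powr (-(\<alpha> + 2)) * b n powr (\<alpha> + 1) = 1 / b n"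
      using elim by (simp add: powr_add[symmetric] powr_minus_divide)
    finally show ?case using l by simp
  qed
  show ?thesis
  \<comment> \<open>The witness is minus the ratio of the probabilities; it makes the identity exact
    as soon as \<open>p n > 0\<close>.\<close>
  proof (intro exI conjI)
    have "((\<lambda>n. B / b n) \<longlongrightarrow> 0) at_top"
      using b(1) by (rule real_tendsto_divide_at_top[OF tendsto_const])
    then have "((\<lambda>n. - (p' n / p n)) \<longlongrightarrow> 0) at_top"
      by (rule Lim_null_comparison[rotated]) (use ratio in \<open>auto elim: eventually_mono\<close>)
    then show "(\<lambda>n. - (p' n / p n)) \<in> o(\<lambda>_. 1)"
      by (intro smalloI_tendsto) auto
    show "\<forall>\<^sub>F n in at_top. sum_tail_prob n (trunc_dist M (u n)) (\<gamma> n) - sum_tail_prob n M (\<gamma> n)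
        = - sum_tail_prob n M (\<gamma> n) * (1 + - (p' n / p n))"
      using ratio by eventually_elim (simp add: p_def p'_def field_simps)
  qed
qed

end
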